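(* Let $\Sigma^2$ be a two-dimensional submanifold (smoothly) immersed in $\mathbb{R}^4$. Then the nonlinearity $Z$ in the contracted Simons identity, namely $$Z=\sum_{i,j,p,\alpha,\beta}H_\alpha h_{ip\alpha}h_{ij\beta}h_{pj\beta}-\sum_{\alpha,\beta}\Big(\sum_{i,j}h_{ij\alpha}h_{ij\beta}\Big)^2-|Rm^\perp|^2,$$ satisfies $$Z=2K|\mathring{A}|^2-2|K^\perp|^2 .$$
   Context: In local orthonormal frames $\{e_1,e_2\}$ of the tangent bundle and $\{\nu_1,\nu_2\}$ of the normal bundle, the second fundamental form $A$ has components $h_{ij\alpha}$, and $H_\alpha=\sum_i h_{ii\alpha}$ are the components of the mean curvature vector $H$. All indices run over $\{1,2\}$. The traceless second fundamental form is $\mathring{A}=A-\frac12 g\otimes H$, so that $|\mathring{A}|^2=|A|^2-\frac12|H|^2$. $K$ is the intrinsic (Gauss) curvature, so that $K=\frac12(|H|^2-|A|^2)$. The normal curvature is $$K^\perp=\sum_{p}\left(h_{1p1}h_{2p2}-h_{2p1}h_{1p2}\right)$$ (defined up to sign), and $$|Rm^\perp|^2=\sum_{i,j,\alpha,\beta}\Big(\sum_p (h_{ip\alpha}h_{jp\beta}-h_{jp\alpha}h_{ip\beta})\Big)^2 .$$ The contracted Simons identity is $\frac12\Delta|A|^2=\sum_{i,j}h_{ij}\cdot\nabla_i\nabla_jH+|\nabla A|^2+Z$. *)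

theory Defs
  imports "HOL-Analysis.Analysis"
begin

section \<open>Smooth maps on open subsets of the coordinate plane\<close>

definition partial_deriv :: "2 \<Rightarrow> (real^2 \<Rightarrow> 'b::real_normed_vector) \<Rightarrow> real^2 \<Rightarrow> 'b" where
  "partial_deriv i f u = frechet_derivative f (at u) (axis i 1)"

text \<open>Only meant for open \<open>U\<close>, where \<open>differentiable_on\<close> is differentiability at each point.\<close>

primrec Ck_on :: "nat \<Rightarrow> (real^2) set \<Rightarrow> (real^2 \<Rightarrow> 'b::real_normed_vector) \<Rightarrow> bool" where
  "Ck_on 0 U f \<longleftrightarrow> continuous_on U f"
| "Ck_on (Suc k) U f \<longleftrightarrow> f differentiable_on U \<and> (\<forall>i. Ck_on k U (partial_deriv i f))"

definition smooth_on :: "(real^2) set \<Rightarrow> (real^2 \<Rightarrow> 'b::real_normed_vector) \<Rightarrow> bool" where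
  "smooth_on U f \<longleftrightarrow> (\<forall>k. Ck_on k U f)"


section \<open>Smooth surfaces and immersions\<close>

text \<open>The manifold is the topological space \<open>X\<close>. An atlas is a set of pairs \<open>(U, x)\<close>, where
  \<open>x\<close> is a local parametrization, i.e. the inverse of a coordinate chart.\<close>

definition smooth_surface ::
    "'a topology \<Rightarrow> ((real^2) set \<times> (real^2 \<Rightarrow> 'a)) set \<Rightarrow> bool" where
  "smooth_surface X \<A> \<longleftrightarrow>
     Hausdorff_space X \<and> second_countable X \<and>
     (\<forall>(U, x) \<in> \<A>. open U \<and> embedding_map (top_of_set U) X x \<and> openin X (x ` U)) \<and>
     (\<Union>(U, x) \<in> \<A>. x ` U) = topspace X \<and>
     (\<forall>(U, x) \<in> \<A>. \<forall>(V, y) \<in> \<A>.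
        smooth_on {u \<in> U. x u \<in> y ` V} (\<lambda>u. inv_into V y (x u)))"

definition smooth_immersion ::
    "((real^2) set \<times> (real^2 \<Rightarrow> 'a)) set \<Rightarrow> ('a \<Rightarrow> real^4) \<Rightarrow> bool" where
  "smooth_immersion \<A> F \<longleftrightarrow>
     (\<forall>(U, x) \<in> \<A>. smooth_on U (F \<circ> x) \<and>
        (\<forall>u \<in> U. inj (frechet_derivative (F \<circ> x) (at u))))"


section \<open>Intrinsic geometry in coordinates\<close>

definition induced_metric :: "(real^2 \<Rightarrow> real^4) \<Rightarrow> real^2 \<Rightarrow> real^2^2" where
  "induced_metric f u = (\<chi> i j. partial_deriv i f u \<bullet> partial_deriv j f u)"

text \<open>\<open>christoffel g k i j\<close> is \<open>\<Gamma>\<close> with upper index \<open>k\<close> and lower indices \<open>i\<close>, \<open>j\<close>.\<close>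

definition christoffel :: "(real^2 \<Rightarrow> real^2^2) \<Rightarrow> 2 \<Rightarrow> 2 \<Rightarrow> 2 \<Rightarrow> real^2 \<Rightarrow> real" where
  "christoffel g k i j u =
     1/2 * (\<Sum>l\<in>UNIV. matrix_inv (g u) $ k $ l *
       (partial_deriv i (\<lambda>w. g w $ j $ l) u
        + partial_deriv j (\<lambda>w. g w $ i $ l) u
        - partial_deriv l (\<lambda>w. g w $ i $ j) u))"

text \<open>\<open>riemann g l i j k\<close> is the \<open>l\<close>-th component of \<open>R(\<partial>\<^sub>i, \<partial>\<^sub>j) \<partial>\<^sub>k\<close>, with the convention
  \<open>R(X, Y) = [\<nabla>\<^sub>X, \<nabla>\<^sub>Y] - \<nabla>\<^bsub>[X,Y]\<^esub>\<close>.\<close>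

definition riemann :: "(real^2 \<Rightarrow> real^2^2) \<Rightarrow> 2 \<Rightarrow> 2 \<Rightarrow> 2 \<Rightarrow> 2 \<Rightarrow> real^2 \<Rightarrow> real" where
  "riemann g l i j k u =
     partial_deriv i (christoffel g l j k) u - partial_deriv j (christoffel g l i k) u
     + (\<Sum>m\<in>UNIV. christoffel g m j k u * christoffel g l i m u
                  - christoffel g m i k u * christoffel g l j m u)"

text \<open>The sectional curvature \<open>g(R(\<partial>\<^sub>1, \<partial>\<^sub>2) \<partial>\<^sub>2, \<partial>\<^sub>1) / det g\<close>, positive for the round sphere.\<close>

definition gauss_curvature :: "(real^2 \<Rightarrow> real^2^2) \<Rightarrow> real^2 \<Rightarrow> real" where
  "gauss_curvature g u = (\<Sum>l\<in>UNIV. riemann g l 1 2 2 u * g u $ l $ 1) / det (g u)"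


section \<open>Extrinsic geometry\<close>

definition normal_part :: "(real^4) set \<Rightarrow> real^4 \<Rightarrow> real^4" where
  "normal_part T y = (THE z. (\<forall>t\<in>T. orthogonal z t) \<and> y - z \<in> T)"

text \<open>Tangent vectors are given by their coordinate vectors in \<open>real^2\<close>; the tangent plane of the
  immersed surface is the range of the derivative. \<open>A(v, w)\<close> is the normal part of the ambient
  derivative in direction \<open>v\<close> of the tangent field \<open>df(w)\<close>, where \<open>w\<close> is extended with constant
  coefficients; other extensions change only the tangential part.\<close>

definition second_fundamental_form ::
    "(real^2 \<Rightarrow> real^4) \<Rightarrow> real^2 \<Rightarrow> real^2 \<Rightarrow> real^2 \<Rightarrow> real^4" where
  "second_fundamental_form f u v w =
     normal_part (range (frechet_derivative f (at u)))
       (frechet_derivative (\<lambda>u'. frechet_derivative f (at u') w) (at u) v)"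

definition orthonormal_tangent_frame ::
    "(real^2 \<Rightarrow> real^4) \<Rightarrow> real^2 \<Rightarrow> (2 \<Rightarrow> real^2) \<Rightarrow> bool" where
  "orthonormal_tangent_frame f u e \<longleftrightarrow>
     (\<forall>i j. frechet_derivative f (at u) (e i) \<bullet> frechet_derivative f (at u) (e j)
             = (if i = j then 1 else 0))"

definition orthonormal_normal_frame ::
    "(real^2 \<Rightarrow> real^4) \<Rightarrow> real^2 \<Rightarrow> (2 \<Rightarrow> real^4) \<Rightarrow> bool" where
  "orthonormal_normal_frame f u \<nu> \<longleftrightarrow>
     (\<forall>\<alpha> \<beta>. \<nu> \<alpha> \<bullet> \<nu> \<beta> = (if \<alpha> = \<beta> then 1 else 0)) \<and>
     (\<forall>\<alpha> v. orthogonal (\<nu> \<alpha>) (frechet_derivative f (at u) v))"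

definition sff_components ::
    "(real^2 \<Rightarrow> real^4) \<Rightarrow> real^2 \<Rightarrow> (2 \<Rightarrow> real^2) \<Rightarrow> (2 \<Rightarrow> real^4) \<Rightarrow> 2 \<Rightarrow> 2 \<Rightarrow> 2 \<Rightarrow> real" where
  "sff_components f u e \<nu> i j \<alpha> = second_fundamental_form f u (e i) (e j) \<bullet> \<nu> \<alpha>"


section \<open>Quantities in orthonormal frames\<close>

text \<open>Below, \<open>h i j \<alpha>\<close> are components with respect to orthonormal frames, \<open>i\<close> and \<open>j\<close> being
  tangential indices and \<open>\<alpha>\<close> a normal one. The type \<open>2\<close> has the two elements \<open>1\<close> and \<open>2\<close>.\<close>

definition mean_curvature :: "(2 \<Rightarrow> 2 \<Rightarrow> 2 \<Rightarrow> real) \<Rightarrow> 2 \<Rightarrow> real" where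
  "mean_curvature h \<alpha> = (\<Sum>i\<in>UNIV. h i i \<alpha>)"

definition traceless :: "(2 \<Rightarrow> 2 \<Rightarrow> 2 \<Rightarrow> real) \<Rightarrow> 2 \<Rightarrow> 2 \<Rightarrow> 2 \<Rightarrow> real" where
  "traceless h i j \<alpha> = h i j \<alpha> - 1/2 * (if i = j then 1 else 0) * mean_curvature h \<alpha>"

definition norm_squared :: "(2 \<Rightarrow> 2 \<Rightarrow> 2 \<Rightarrow> real) \<Rightarrow> real" where
  "norm_squared h = (\<Sum>i\<in>UNIV. \<Sum>j\<in>UNIV. \<Sum>\<alpha>\<in>UNIV. (h i j \<alpha>)\<^sup>2)"

definition normal_curvature :: "(2 \<Rightarrow> 2 \<Rightarrow> 2 \<Rightarrow> real) \<Rightarrow> real" where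
  "normal_curvature h = (\<Sum>p\<in>UNIV. h 1 p 1 * h 2 p 2 - h 2 p 1 * h 1 p 2)"

definition Rm_perp_squared :: "(2 \<Rightarrow> 2 \<Rightarrow> 2 \<Rightarrow> real) \<Rightarrow> real" where
  "Rm_perp_squared h =
     (\<Sum>i\<in>UNIV. \<Sum>j\<in>UNIV. \<Sum>\<alpha>\<in>UNIV. \<Sum>\<beta>\<in>UNIV.
        (\<Sum>p\<in>UNIV. h i p \<alpha> * h j p \<beta> - h j p \<alpha> * h i p \<beta>)\<^sup>2)"

definition simons_Z :: "(2 \<Rightarrow> 2 \<Rightarrow> 2 \<Rightarrow> real) \<Rightarrow> real" where
  "simons_Z h =
     (\<Sum>i\<in>UNIV. \<Sum>j\<in>UNIV. \<Sum>p\<in>UNIV. \<Sum>\<alpha>\<in>UNIV. \<Sum>\<beta>\<in>UNIV.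
        mean_curvature h \<alpha> * h i p \<alpha> * h i j \<beta> * h p j \<beta>)
     - (\<Sum>\<alpha>\<in>UNIV. \<Sum>\<beta>\<in>UNIV. (\<Sum>i\<in>UNIV. \<Sum>j\<in>UNIV. h i j \<alpha> * h i j \<beta>)\<^sup>2)
     - Rm_perp_squared h"

end

theory Submission
  imports Defs
begin

text \<open>
  For an immersion \<open>f\<close> of an open subset of the plane, the vectors \<open>\<partial>\<^sub>i\<partial>\<^sub>jf - \<Sum>\<^sub>k \<Gamma>\<^sup>k\<^sub>i\<^sub>j \<partial>\<^sub>kf\<close> are
  orthogonal to the tangent plane. Differentiating this orthogonality relation expresses the
  derivatives of the Christoffel symbols through third derivatives of \<open>f\<close>, which cancel in the
  curvature tensor; what remains is the Gauss equation \<open>K = \<Sum>\<^sub>\<alpha> (h\<^sub>1\<^sub>1\<^sub>\<alpha> h\<^sub>2\<^sub>2\<^sub>\<alpha> - h\<^sub>1\<^sub>2\<^sub>\<alpha>\<^sup>2)\<close>.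
  With \<open>K\<close> in this form and \<open>h\<close> symmetric, the claim is a polynomial identity in the \<open>h\<^sub>i\<^sub>j\<^sub>\<alpha>\<close>.
\<close>

section \<open>Symmetry of mixed partial derivatives\<close>

text \<open>Two mean value theorems in succession: one along \<open>v\<close> for the increment of
  \<open>f\<close> by \<open>s *\<^sub>R w\<close>, then one along \<open>w\<close> for
  \<open>fv\<close>. Only directional derivatives are needed for this.\<close>

lemma double_difference_mean_value:
  fixes f :: "'a::real_normed_vector \<Rightarrow> real"
  assumes S: "\<And>\<sigma> \<tau>. \<lbrakk>0 \<le> \<sigma>; \<sigma> \<le> s; 0 \<le> \<tau>; \<tau> \<le> s\<rbrakk> \<Longrightarrow> a + \<sigma> *\<^sub>R v + \<tau> *\<^sub>R w \<in> S"
    and "s > 0"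
    and fv: "\<And>x. x \<in> S \<Longrightarrow> ((\<lambda>t. f (x + t *\<^sub>R v)) has_real_derivative fv x) (at 0)"
    and fvw: "\<And>x. x \<in> S \<Longrightarrow> ((\<lambda>t. fv (x + t *\<^sub>R w)) has_real_derivative fvw x) (at 0)"
  obtains \<sigma> \<tau> where "0 \<le> \<sigma>" "\<sigma> \<le> s" "0 \<le> \<tau>" "\<tau> \<le> s"
    "f (a + s *\<^sub>R v + s *\<^sub>R w) - f (a + s *\<^sub>R v) - f (a + s *\<^sub>R w) + f a
       = s * s * fvw (a + \<sigma> *\<^sub>R v + \<tau> *\<^sub>R w)"
proof -
  \<comment> \<open>The hypotheses give derivatives at parameter 0 for every base point; moving the
    base point along the line gives them at every parameter, as the mean value theorem
    requires.\<close>
  have shift: "((\<lambda>t. \<phi> (b + t *\<^sub>R y)) has_real_derivative d) (at t0)"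
    if "((\<lambda>t. \<phi> (b + t0 *\<^sub>R y + t *\<^sub>R y)) has_real_derivative d) (at 0)"
    for \<phi> :: "'a \<Rightarrow> real" and b y d t0
  proof -
    have "((\<lambda>t. \<phi> (b + (t + t0) *\<^sub>R y)) has_real_derivative d) (at 0)"
      using that by (simp add: algebra_simps)
    then show ?thesis
      using DERIV_shift[of "\<lambda>t. \<phi> (b + t *\<^sub>R y)" d 0 t0] by simp
  qed
  define g where "g t = f (a + s *\<^sub>R w + t *\<^sub>R v) - f (a + t *\<^sub>R v)" for t
  have "(g has_real_derivative fv (a + s *\<^sub>R w + t *\<^sub>R v) - fv (a + t *\<^sub>R v)) (at t)"
    if t: "0 \<le> t" "t \<le> s" for t
  proof -
    have "a + s *\<^sub>R w + t *\<^sub>R v \<in> S" "a + t *\<^sub>R v \<in> S"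
      using S[of t s] S[of t 0] t \<open>s > 0\<close> by (simp_all add: algebra_simps)
    then show ?thesis
      unfolding g_def
      by (intro DERIV_diff shift[of f "a + s *\<^sub>R w" t v] shift[of f a t v] fv)
  qed
  from MVT2[OF \<open>s > 0\<close> this] obtain \<sigma> where \<sigma>: "0 < \<sigma>" "\<sigma> < s"
    "g s - g 0 = (s - 0) * (fv (a + s *\<^sub>R w + \<sigma> *\<^sub>R v) - fv (a + \<sigma> *\<^sub>R v))"
    by blast
  have "((\<lambda>t. fv (a + \<sigma> *\<^sub>R v + t *\<^sub>R w)) has_real_derivative fvw (a + \<sigma> *\<^sub>R v + t *\<^sub>R w)) (at t)"
    if t: "0 \<le> t" "t \<le> s" for t
    using S[of \<sigma> t] t \<sigma> by (intro shift[of fv "a + \<sigma> *\<^sub>R v" t w] fvw) auto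
  from MVT2[OF \<open>s > 0\<close> this] obtain \<tau> where \<tau>: "0 < \<tau>" "\<tau> < s"
    "fv (a + \<sigma> *\<^sub>R v + s *\<^sub>R w) - fv (a + \<sigma> *\<^sub>R v + 0 *\<^sub>R w) = (s - 0) * fvw (a + \<sigma> *\<^sub>R v + \<tau> *\<^sub>R w)"
    by blast
  have "g s - g 0 = s * s * fvw (a + \<sigma> *\<^sub>R v + \<tau> *\<^sub>R w)"
    using \<sigma>(3) \<tau>(3) by (simp add: add.commute add.left_commute)
  then show ?thesis
    using that[of \<sigma> \<tau>] \<sigma> \<tau> by (simp add: g_def algebra_simps)
qed

text \<open>The double difference over a small parallelogram is symmetric in \<open>v\<close> and
  \<open>w\<close>. It therefore equals \<open>s * s\<close> times a value of \<open>fvw\<close> and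
  also \<open>s * s\<close> times a value of \<open>fwv\<close>, both taken near \<open>a\<close>,
  and continuity at \<open>a\<close> forces the two limits to agree.\<close>

lemma mixed_directional_derivatives_commute:
  fixes f :: "'a::real_normed_vector \<Rightarrow> real"
  assumes "open S" "a \<in> S"
    and fv: "\<And>x. x \<in> S \<Longrightarrow> ((\<lambda>t. f (x + t *\<^sub>R v)) has_real_derivative fv x) (at 0)"
    and fw: "\<And>x. x \<in> S \<Longrightarrow> ((\<lambda>t. f (x + t *\<^sub>R w)) has_real_derivative fw x) (at 0)"
    and fvw: "\<And>x. x \<in> S \<Longrightarrow> ((\<lambda>t. fv (x + t *\<^sub>R w)) has_real_derivative fvw x) (at 0)"
    and fwv: "\<And>x. x \<in> S \<Longrightarrow> ((\<lambda>t. fw (x + t *\<^sub>R v)) has_real_derivative fwv x) (at 0)"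
    and cont: "isCont fvw a" "isCont fwv a"
  shows "fvw a = fwv a"
proof (rule ccontr)
  assume neq: "fvw a \<noteq> fwv a"
  \<comment> \<open>Half the gap: if \<open>fvw\<close> and \<open>fwv\<close> take a common value,
    each less than \<epsilon> away from its own value at \<open>a\<close>, then the gap is strictly
    smaller than itself.\<close>
  define \<epsilon> where "\<epsilon> = dist (fvw a) (fwv a) / 2"
  have "\<epsilon> > 0" using neq by (simp add: \<epsilon>_def)
  then have "\<forall>\<^sub>F x in nhds a. x \<in> S \<and> dist (fvw x) (fvw a) < \<epsilon> \<and> dist (fwv x) (fwv a) < \<epsilon>"
    using cont \<open>open S\<close> \<open>a \<in> S\<close>
    by (intro eventually_conj eventually_nhds_in_open tendstoD)
       (auto simp: isCont_def intro: tendsto_at_iff_tendsto_nhds[THEN iffD1])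
  then obtain r where "r > 0"
    and r: "\<And>x. dist x a < r \<Longrightarrow> x \<in> S \<and> dist (fvw x) (fvw a) < \<epsilon> \<and> dist (fwv x) (fwv a) < \<epsilon>"
    unfolding eventually_nhds_metric by auto
  \<comment> \<open>Small enough for the parallelogram with sides \<open>s *\<^sub>R v\<close> and
    \<open>s *\<^sub>R w\<close> to lie in the ball of radius \<open>r\<close>; the summand 1 keeps
    the denominator positive when both vectors vanish.\<close>
  define s where "s = r / (norm v + norm w + 1)"
  have pos: "norm v + norm w + 1 > 0"
    by (simp add: add_nonneg_pos)
  have "s > 0" using \<open>r > 0\<close> pos by (simp add: s_def)
  have near: "dist (a + \<sigma> *\<^sub>R v + \<tau> *\<^sub>R w) a < r" if "0 \<le> \<sigma>" "\<sigma> \<le> s" "0 \<le> \<tau>" "\<tau> \<le> s" for \<sigma> \<tau>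
  proof -
    have "dist (a + \<sigma> *\<^sub>R v + \<tau> *\<^sub>R w) a = norm (\<sigma> *\<^sub>R v + \<tau> *\<^sub>R w)"
      by (simp add: dist_norm)
    also have "\<dots> \<le> \<sigma> * norm v + \<tau> * norm w"
      using norm_triangle_ineq[of "\<sigma> *\<^sub>R v" "\<tau> *\<^sub>R w"] that by simp
    also have "\<dots> \<le> s * norm v + s * norm w"
      using that by (intro add_mono mult_right_mono) auto
    also have "\<dots> < s * (norm v + norm w + 1)"
      using \<open>s > 0\<close> by (simp add: algebra_simps)
    also have "\<dots> = r" using pos by (simp add: s_def)
    finally show ?thesis .
  qed
  have near': "dist (a + \<tau> *\<^sub>R w + \<sigma> *\<^sub>R v) a < r" if "0 \<le> \<tau>" "\<tau> \<le> s" "0 \<le> \<sigma>" "\<sigma> \<le> s" for \<sigma> \<tau>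
    using near[of \<sigma> \<tau>] that by (simp add: add.assoc add.commute[of "\<tau> *\<^sub>R w"])
  have "a + \<sigma> *\<^sub>R v + \<tau> *\<^sub>R w \<in> S" if "0 \<le> \<sigma>" "\<sigma> \<le> s" "0 \<le> \<tau>" "\<tau> \<le> s" for \<sigma> \<tau>
    using r near that by blast
  from double_difference_mean_value[OF this \<open>s > 0\<close> fv fvw] obtain \<sigma> \<tau> where
    1: "0 \<le> \<sigma>" "\<sigma> \<le> s" "0 \<le> \<tau>" "\<tau> \<le> s"
    "f (a + s *\<^sub>R v + s *\<^sub>R w) - f (a + s *\<^sub>R v) - f (a + s *\<^sub>R w) + f a
       = s * s * fvw (a + \<sigma> *\<^sub>R v + \<tau> *\<^sub>R w)"
    by blast
  have "a + \<tau> *\<^sub>R w + \<sigma> *\<^sub>R v \<in> S" if "0 \<le> \<tau>" "\<tau> \<le> s" "0 \<le> \<sigma>" "\<sigma> \<le> s" for \<sigma> \<tau>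
    using r near' that by blast
  from double_difference_mean_value[OF this \<open>s > 0\<close> fw fwv] obtain \<tau>' \<sigma>' where
    2: "0 \<le> \<tau>'" "\<tau>' \<le> s" "0 \<le> \<sigma>'" "\<sigma>' \<le> s"
    "f (a + s *\<^sub>R w + s *\<^sub>R v) - f (a + s *\<^sub>R w) - f (a + s *\<^sub>R v) + f a
       = s * s * fwv (a + \<tau>' *\<^sub>R w + \<sigma>' *\<^sub>R v)"
    by blast
  have "s * s * fvw (a + \<sigma> *\<^sub>R v + \<tau> *\<^sub>R w) = s * s * fwv (a + \<tau>' *\<^sub>R w + \<sigma>' *\<^sub>R v)"
    using 1(5) 2(5) by (simp only: add.assoc add.commute[of "s *\<^sub>R w" "s *\<^sub>R v"])
  then have "fvw (a + \<sigma> *\<^sub>R v + \<tau> *\<^sub>R w) = fwv (a + \<tau>' *\<^sub>R w + \<sigma>' *\<^sub>R v)"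
    using \<open>s > 0\<close> by simp
  then show False
    using r[OF near[OF 1(1-4)]] r[OF near'[OF 2(1-4)]]
    by (simp add: \<epsilon>_def dist_real_def abs_if split: if_splits)
qed

section \<open>Calculus of smooth maps\<close>

lemma partial_deriv_eqI: "(f has_derivative D) (at u) \<Longrightarrow> partial_deriv i f u = D (axis i 1)"
  unfolding partial_deriv_def by (metis frechet_derivative_at)

lemma frechet_derivative_eq_partial_deriv:
  assumes "f differentiable (at u)"
  shows "frechet_derivative f (at u) v = (\<Sum>i\<in>UNIV. v $ i *\<^sub>R partial_deriv i f u)"
proof -
  have lin: "linear (frechet_derivative f (at u))"
    using assms by (rule linear_frechet_derivative)
  have "v = (\<Sum>i\<in>UNIV. v $ i *\<^sub>R axis i 1)"
    using basis_expansion[of v] by (simp add: scalar_mult_eq_scaleR)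
  then have "frechet_derivative f (at u) v = frechet_derivative f (at u) (\<Sum>i\<in>UNIV. v $ i *\<^sub>R axis i 1)"
    by simp
  also have "\<dots> = (\<Sum>i\<in>UNIV. v $ i *\<^sub>R partial_deriv i f u)"
    by (simp add: linear_sum[OF lin] linear_cmul[OF lin] partial_deriv_def)
  finally show ?thesis .
qed

lemma partial_deriv_cong_open:
  assumes "open U" "u \<in> U" "\<And>w. w \<in> U \<Longrightarrow> f w = g w" "g differentiable (at u)"
  shows "partial_deriv i f u = partial_deriv i g u"
  unfolding partial_deriv_def
  by (subst frechet_derivative_transform_within_open[OF assms(4,1,2)]) (use assms in auto)

lemma partial_deriv_mult:
  fixes f g :: "real^2 \<Rightarrow> real"
  assumes "f differentiable (at u)" "g differentiable (at u)"
  shows "partial_deriv i (\<lambda>w. f w * g w) u = partial_deriv i f u * g u + f u * partial_deriv i g u"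
  unfolding partial_deriv_eqI[OF has_derivative_mult[OF assms[unfolded frechet_derivative_works]]]
  by (simp add: partial_deriv_def)

lemma partial_deriv_add:
  assumes "f differentiable (at u)" "g differentiable (at u)"
  shows "partial_deriv i (\<lambda>w. f w + g w) u = partial_deriv i f u + partial_deriv i g u"
  unfolding partial_deriv_eqI[OF has_derivative_add[OF assms[unfolded frechet_derivative_works]]]
  by (simp add: partial_deriv_def)

lemma partial_deriv_inner:
  assumes "f differentiable (at u)" "g differentiable (at u)"
  shows "partial_deriv i (\<lambda>w. f w \<bullet> g w) u = partial_deriv i f u \<bullet> g u + f u \<bullet> partial_deriv i g u"
  unfolding partial_deriv_eqI[OF has_derivative_inner[OF assms[unfolded frechet_derivative_works]]]
  by (simp add: partial_deriv_def)

lemma differentiable_inner_at: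
  assumes "f differentiable (at u)" "g differentiable (at u)"
  shows "(\<lambda>w. f w \<bullet> g w) differentiable (at u)"
  using assms has_derivative_inner unfolding differentiable_def by blast

lemma smooth_on_partial_deriv: "smooth_on U f \<Longrightarrow> smooth_on U (partial_deriv i f)"
  unfolding smooth_on_def by (metis Ck_on.simps(2))

lemma smooth_on_imp_differentiable:
  assumes "smooth_on U f" "open U" "u \<in> U"
  shows "f differentiable (at u)"
proof -
  have "f differentiable_on U"
    using assms(1) unfolding smooth_on_def by (metis Ck_on.simps(2))
  then show ?thesis
    using assms(2,3) at_within_open unfolding differentiable_on_def by metis
qed

text \<open>Pairing with a fixed \<open>b\<close> turns a vector-valued map into a real-valued one,
  in the form that \<open>mixed_directional_derivatives_commute\<close> expects.\<close>

lemma has_real_derivative_inner_along_axis: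
  assumes "smooth_on U f" "open U" "u \<in> U"
  shows "((\<lambda>t. f (u + t *\<^sub>R axis i 1) \<bullet> b) has_real_derivative partial_deriv i f u \<bullet> b) (at 0)"
proof -
  let ?D = "frechet_derivative f (at u)"
  have f: "(f has_derivative ?D) (at u)"
    using smooth_on_imp_differentiable[OF assms] by (simp add: frechet_derivative_works)
  have "((\<lambda>t. u + t *\<^sub>R axis i 1) has_derivative (\<lambda>t. t *\<^sub>R axis i 1)) (at 0)"
    by (auto intro!: derivative_eq_intros)
  then have "((\<lambda>t. f (u + t *\<^sub>R axis i 1)) has_derivative (\<lambda>t. ?D (t *\<^sub>R axis i 1))) (at 0)"
    by (rule has_derivative_compose) (use f in simp)
  then have "((\<lambda>t. f (u + t *\<^sub>R axis i 1) \<bullet> b) has_derivative (\<lambda>t. ?D (t *\<^sub>R axis i 1) \<bullet> b)) (at 0)"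
    by (rule has_derivative_inner_left)
  moreover have "(\<lambda>t. ?D (t *\<^sub>R axis i 1) \<bullet> b) = (*) (partial_deriv i f u \<bullet> b)"
    by (simp add: fun_eq_iff partial_deriv_def linear_cmul[OF has_derivative_linear[OF f]])
  ultimately show ?thesis by (simp add: has_field_derivative_def)
qed

text \<open>A vector is determined by its inner products with all \<open>b\<close>, so the
  real-valued case along two coordinate axes suffices.\<close>

lemma partial_deriv_commute:
  fixes f :: "real^2 \<Rightarrow> 'b::real_inner"
  assumes "smooth_on U f" "open U" "u \<in> U"
  shows "partial_deriv i (partial_deriv j f) u = partial_deriv j (partial_deriv i f) u"
proof -
  have cont: "isCont (\<lambda>w. partial_deriv i (partial_deriv j f) w \<bullet> b) u" for i j b
    using assms
    by (intro continuous_intros differentiable_imp_continuous_within smooth_on_imp_differentiable[of U]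
        smooth_on_partial_deriv)
  have "partial_deriv i (partial_deriv j f) u \<bullet> b = partial_deriv j (partial_deriv i f) u \<bullet> b" for b
    by (rule mixed_directional_derivatives_commute[OF assms(2,3),
          where f = "\<lambda>w. f w \<bullet> b" and fv = "\<lambda>w. partial_deriv j f w \<bullet> b" and v = "axis j 1"
          and fw = "\<lambda>w. partial_deriv i f w \<bullet> b" and w = "axis i 1"])
       (use assms cont in \<open>auto intro!: has_real_derivative_inner_along_axis[of U] smooth_on_partial_deriv\<close>)
  then show ?thesis using vector_eq_rdot by blast
qed

section \<open>The Gauss equation\<close>

text \<open>Resolves the definite description: two candidates differ by an element of
  \<open>T\<close>, and both are orthogonal to that difference, so it is orthogonal to
  itself.\<close>

lemma normal_part_eqI:
  assumes "subspace T" and orth: "\<And>t. t \<in> T \<Longrightarrow> z \<bullet> t = 0" and "y - z \<in> T"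
  shows "normal_part T y = z"
  unfolding normal_part_def
proof (rule the_equality)
  show "(\<forall>t\<in>T. orthogonal z t) \<and> y - z \<in> T"
    using assms by (simp add: orthogonal_def)
  fix z' assume z': "(\<forall>t\<in>T. orthogonal z' t) \<and> y - z' \<in> T"
  have "(y - z) - (y - z') \<in> T"
    using assms(1,3) z' subspace_diff by blast
  then have "z' - z \<in> T" by simp
  then have "z' \<bullet> (z' - z) = 0" "z \<bullet> (z' - z) = 0"
    using z' orth by (auto simp: orthogonal_def)
  then have "(z' - z) \<bullet> (z' - z) = 0"
    by (simp add: inner_diff_left)
  then show "z' = z" by simp
qed

lemma matrix_mult_matrix_inv:
  assumes "invertible A"
  shows "A ** matrix_inv A = mat 1"
  using assms unfolding invertible_def matrix_inv_def by (rule someI2_ex) blast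

text \<open>Models the composite of the immersion with a single parametrization. The claim is
  pointwise and local, so all the calculus takes place here.\<close>

locale immersed_patch =
  fixes f :: "real^2 \<Rightarrow> real^4" and U :: "(real^2) set"
  assumes smooth: "smooth_on U f" and open_U: "open U"
    and inj: "\<And>u. u \<in> U \<Longrightarrow> inj (frechet_derivative f (at u))"
begin

abbreviation d :: "2 \<Rightarrow> real^2 \<Rightarrow> real^4" where
  "d i \<equiv> partial_deriv i f"

abbreviation dd :: "2 \<Rightarrow> 2 \<Rightarrow> real^2 \<Rightarrow> real^4" where
  "dd i j \<equiv> partial_deriv i (partial_deriv j f)"

abbreviation g :: "real^2 \<Rightarrow> real^2^2" where
  "g \<equiv> induced_metric f"

abbreviation \<Gamma> :: "2 \<Rightarrow> 2 \<Rightarrow> 2 \<Rightarrow> real^2 \<Rightarrow> real" where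
  "\<Gamma> \<equiv> christoffel g"

lemma diffs:
  assumes "u \<in> U"
  shows "f differentiable (at u)" "d i differentiable (at u)" "dd i j differentiable (at u)"
  using assms smooth open_U smooth_on_imp_differentiable smooth_on_partial_deriv by metis+

lemma dd_commute: "u \<in> U \<Longrightarrow> dd i j u = dd j i u"
  using smooth open_U by (rule partial_deriv_commute)

lemma g_nth: "g u $ i $ j = d i u \<bullet> d j u"
  by (simp add: induced_metric_def)

lemma frechet_derivative_f: "u \<in> U \<Longrightarrow> frechet_derivative f (at u) v = v $ 1 *\<^sub>R d 1 u + v $ 2 *\<^sub>R d 2 u"
  using frechet_derivative_eq_partial_deriv[OF diffs(1), of u v] by (simp add: sum_2)

lemma det_g: "det (g u) = (d 1 u \<bullet> d 1 u) * (d 2 u \<bullet> d 2 u) - (d 1 u \<bullet> d 2 u) * (d 1 u \<bullet> d 2 u)"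
  by (simp add: det_2 g_nth inner_commute)

text \<open>Injectivity of the derivative, restated as linear independence of the coordinate tangent
  vectors.\<close>

lemma eq_0_of_df_eq_0:
  assumes "u \<in> U" "a *\<^sub>R d 1 u + b *\<^sub>R d 2 u = 0"
  shows "a = 0" "b = 0"
proof -
  let ?v = "vector [a, b] :: real^2"
  have "frechet_derivative f (at u) ?v = frechet_derivative f (at u) 0"
    using assms by (simp add: frechet_derivative_f)
  then have "?v = 0" using inj[OF assms(1)] by (meson injD)
  then show "a = 0" "b = 0" by (metis vector_2 zero_index)+
qed

lemma det_g_nonzero:
  assumes "u \<in> U"
  shows "det (g u) \<noteq> 0"
proof
  assume 0: "det (g u) = 0"
  \<comment> \<open>Gram-Schmidt without division: \<open>z\<close> below is the component of
    \<open>d 2 u\<close> orthogonal to \<open>d 1 u\<close>, scaled by the squared length of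
    \<open>d 1 u\<close>.\<close>
  define a b where "a = - (d 1 u \<bullet> d 2 u)" and "b = d 1 u \<bullet> d 1 u"
  define z where "z = a *\<^sub>R d 1 u + b *\<^sub>R d 2 u"
  have "z \<bullet> z = b * det (g u)"
    unfolding det_g z_def by (simp add: a_def b_def inner_simps inner_commute algebra_simps)
  then have "z = 0" using 0 by simp
  then have "b = 0" using eq_0_of_df_eq_0 assms unfolding z_def by blast
  then have "1 *\<^sub>R d 1 u + 0 *\<^sub>R d 2 u = 0" by (simp add: b_def)
  then show False using eq_0_of_df_eq_0(1)[OF assms] by fastforce
qed

section \<open>Christoffel symbols of the induced metric\<close>

lemma partial_deriv_g:
  "u \<in> U \<Longrightarrow> partial_deriv k (\<lambda>w. g w $ i $ j) u = dd k i u \<bullet> d j u + d i u \<bullet> dd k j u"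
  by (simp add: g_nth partial_deriv_inner diffs)

text \<open>The three metric derivatives expand into six products; by symmetry of the second
  derivatives four of them cancel and the other two coincide.\<close>

lemma christoffel_eq:
  assumes "u \<in> U"
  shows "\<Gamma> k i j u = (\<Sum>l\<in>UNIV. matrix_inv (g u) $ k $ l * (dd i j u \<bullet> d l u))"
proof -
  have first_kind: "dd i j u \<bullet> d l u + d j u \<bullet> dd i l u + (dd j i u \<bullet> d l u + d i u \<bullet> dd j l u)
        - (dd l i u \<bullet> d j u + d i u \<bullet> dd l j u) = 2 * (dd i j u \<bullet> d l u)" for l
    using dd_commute[OF assms, of j i] dd_commute[OF assms, of l i] dd_commute[OF assms, of l j]
    by (simp add: inner_commute)
  then show ?thesis
    unfolding christoffel_def partial_deriv_g[OF assms] first_kind by (simp add: sum_distrib_left)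
qed

text \<open>Lowering the upper index cancels the inverse metric. Thus the combination of
  \<open>d 1 u\<close> and \<open>d 2 u\<close> with coefficients \<Gamma> is the tangential part of
  \<open>dd i j u\<close>.\<close>

lemma christoffel_lower:
  assumes "u \<in> U"
  shows "\<Gamma> 1 i j u * (d 1 u \<bullet> d m u) + \<Gamma> 2 i j u * (d 2 u \<bullet> d m u) = dd i j u \<bullet> d m u"
proof -
  have "invertible (g u)" using det_g_nonzero[OF assms] by (simp add: invertible_det_nz)
  then have "g u ** matrix_inv (g u) = mat 1" 
    by (rule matrix_mult_matrix_inv)
  then have "(g u ** matrix_inv (g u)) $ m $ l = (if m = l then 1 else 0)" for l
    by (simp add: mat_def)
  then have inv: "(d 1 u \<bullet> d m u) * matrix_inv (g u) $ 1 $ l + (d 2 u \<bullet> d m u) * matrix_inv (g u) $ 2 $ l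
      = (if m = l then 1 else 0)" for l
    by (simp add: matrix_matrix_mult_def sum_2 g_nth inner_commute)
  have "\<Gamma> 1 i j u * (d 1 u \<bullet> d m u) + \<Gamma> 2 i j u * (d 2 u \<bullet> d m u)
     = (\<Sum>l\<in>UNIV. ((d 1 u \<bullet> d m u) * matrix_inv (g u) $ 1 $ l + (d 2 u \<bullet> d m u) * matrix_inv (g u) $ 2 $ l)
          * (dd i j u \<bullet> d l u))"
    by (simp add: christoffel_eq[OF assms] sum_2 algebra_simps)
  also have "\<dots> = dd i j u \<bullet> d m u"
    by (simp add: inv if_distrib[of "\<lambda>t. t * _"] cong: if_cong)
  finally show ?thesis .
qed

text \<open>Cramer's rule for the system in \<open>christoffel_lower\<close>. The explicit
  quotients, with denominator \<open>det (g u)\<close>, show that \<Gamma> is differentiable without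
  differentiating \<open>matrix_inv\<close>.\<close>

lemma christoffel_cramer:
  assumes "u \<in> U"
  shows "\<Gamma> 1 i j u = ((dd i j u \<bullet> d 1 u) * (d 2 u \<bullet> d 2 u) - (dd i j u \<bullet> d 2 u) * (d 1 u \<bullet> d 2 u))
           / ((d 1 u \<bullet> d 1 u) * (d 2 u \<bullet> d 2 u) - (d 1 u \<bullet> d 2 u) * (d 1 u \<bullet> d 2 u))"
    and "\<Gamma> 2 i j u = ((dd i j u \<bullet> d 2 u) * (d 1 u \<bullet> d 1 u) - (dd i j u \<bullet> d 1 u) * (d 1 u \<bullet> d 2 u))
           / ((d 1 u \<bullet> d 1 u) * (d 2 u \<bullet> d 2 u) - (d 1 u \<bullet> d 2 u) * (d 1 u \<bullet> d 2 u))"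
proof -
  note nz = det_g_nonzero[OF assms, unfolded det_g]
  show "\<Gamma> 1 i j u = ((dd i j u \<bullet> d 1 u) * (d 2 u \<bullet> d 2 u) - (dd i j u \<bullet> d 2 u) * (d 1 u \<bullet> d 2 u))
           / ((d 1 u \<bullet> d 1 u) * (d 2 u \<bullet> d 2 u) - (d 1 u \<bullet> d 2 u) * (d 1 u \<bullet> d 2 u))"
    and "\<Gamma> 2 i j u = ((dd i j u \<bullet> d 2 u) * (d 1 u \<bullet> d 1 u) - (dd i j u \<bullet> d 1 u) * (d 1 u \<bullet> d 2 u))
           / ((d 1 u \<bullet> d 1 u) * (d 2 u \<bullet> d 2 u) - (d 1 u \<bullet> d 2 u) * (d 1 u \<bullet> d 2 u))"
    using nz christoffel_lower[OF assms, of i j 1, symmetric] christoffel_lower[OF assms, of i j 2, symmetric]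
    by (simp_all add: nonzero_eq_divide_eq inner_commute[of "d 2 u" "d 1 u"] algebra_simps)
qed

lemma differentiable_christoffel:
  assumes "u \<in> U"
  shows "\<Gamma> k i j differentiable (at u)"
proof -
  \<comment> \<open>Cramer's formulas are available only on \<open>U\<close>; agreement on this open
    set is enough to carry differentiability over.\<close>
  have transfer: "\<phi> differentiable (at u)"
    if "\<psi> differentiable (at u)" "\<And>w. w \<in> U \<Longrightarrow> \<phi> w = \<psi> w" for \<phi> \<psi> :: "real^2 \<Rightarrow> real"
    using that assms open_U has_derivative_transform_within_open[of \<psi> _ u UNIV U \<phi>]
    unfolding differentiable_def by metis
  have "\<Gamma> 1 i j differentiable (at u)" "\<Gamma> 2 i j differentiable (at u)"
    using det_g_nonzero[OF assms, unfolded det_g]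
    by (auto intro!: transfer[OF _ christoffel_cramer(1)] transfer[OF _ christoffel_cramer(2)]
        differentiable_divide differentiable_diff differentiable_mult differentiable_inner_at diffs assms)
  then show ?thesis using exhaust_2[of k] by auto
qed

text \<open>The product rule applied to \<open>christoffel_lower\<close>. The left side is the
  combination of derivatives of \<Gamma> that appears once the upper index of the curvature tensor
  is lowered.\<close>

lemma partial_deriv_christoffel_lower:
  assumes u: "u \<in> U"
  shows "partial_deriv n (\<Gamma> 1 i j) u * (d 1 u \<bullet> d m u) + partial_deriv n (\<Gamma> 2 i j) u * (d 2 u \<bullet> d m u)
    = partial_deriv n (dd i j) u \<bullet> d m u + dd i j u \<bullet> dd n m u
      - \<Gamma> 1 i j u * (dd n 1 u \<bullet> d m u + d 1 u \<bullet> dd n m u)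
      - \<Gamma> 2 i j u * (dd n 2 u \<bullet> d m u + d 2 u \<bullet> dd n m u)"
proof -
  have "partial_deriv n (\<lambda>w. \<Gamma> 1 i j w * (d 1 w \<bullet> d m w) + \<Gamma> 2 i j w * (d 2 w \<bullet> d m w)) u
      = partial_deriv n (\<lambda>w. dd i j w \<bullet> d m w) u"
    by (rule partial_deriv_cong_open[OF open_U u]) (auto intro!: christoffel_lower differentiable_inner_at diffs u)
  then show ?thesis
    by (simp add: partial_deriv_add partial_deriv_mult partial_deriv_inner differentiable_inner_at
        differentiable_mult differentiable_christoffel diffs u algebra_simps)
qed

section \<open>Normal parts of second derivatives and the Gauss equation\<close>

definition normal_dd :: "2 \<Rightarrow> 2 \<Rightarrow> real^2 \<Rightarrow> real^4" where
  "normal_dd i j u = dd i j u - (\<Gamma> 1 i j u *\<^sub>R d 1 u + \<Gamma> 2 i j u *\<^sub>R d 2 u)"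

lemma normal_dd_commute: "u \<in> U \<Longrightarrow> normal_dd i j u = normal_dd j i u"
  by (simp add: normal_dd_def christoffel_eq dd_commute[of u i j])

text \<open>The combination subtracted in \<open>normal_dd\<close> is the tangential part, so
  \<open>normal_dd i j u\<close> is the value of the second fundamental form on the
  \<open>i\<close>-th and \<open>j\<close>-th coordinate vectors.\<close>

lemma normal_dd_orthogonal: "u \<in> U \<Longrightarrow> normal_dd i j u \<bullet> d m u = 0"
  using christoffel_lower[of u i j m] by (simp add: normal_dd_def inner_simps)

text \<open>Orthogonality removes the tangential correction of the first factor; that of the second
  is left expanded, to match the quadratic terms of the curvature tensor.\<close>

lemma normal_dd_inner:
  assumes "u \<in> U"
  shows "normal_dd i j u \<bullet> normal_dd k l u
    = dd i j u \<bullet> dd k l u - \<Gamma> 1 k l u * (dd i j u \<bullet> d 1 u) - \<Gamma> 2 k l u * (dd i j u \<bullet> d 2 u)"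
proof -
  have "normal_dd i j u \<bullet> normal_dd k l u = dd i j u \<bullet> normal_dd k l u"
    using normal_dd_orthogonal[OF assms]
    by (subst normal_dd_def) (simp add: inner_simps inner_commute[of "d _ u" "normal_dd _ _ u"])
  then show ?thesis by (simp add: normal_dd_def inner_simps)
qed

theorem gauss_equation:
  assumes u: "u \<in> U"
  shows "gauss_curvature g u * det (g u)
    = normal_dd 1 1 u \<bullet> normal_dd 2 2 u - normal_dd 1 2 u \<bullet> normal_dd 1 2 u"
proof -
  have third: "partial_deriv 1 (dd 2 2) u = partial_deriv 2 (dd 1 2) u"
    using smooth_on_partial_deriv[OF smooth] open_U u by (rule partial_deriv_commute)
  have "gauss_curvature g u * det (g u) = (\<Sum>l\<in>UNIV. riemann g l 1 2 2 u * (d l u \<bullet> d 1 u))"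
    using det_g_nonzero[OF u] by (simp add: gauss_curvature_def g_nth)
  \<comment> \<open>Grouped so that every bracket is the left side of
    \<open>partial_deriv_christoffel_lower\<close> or of \<open>christoffel_lower\<close> with
    \<open>m = 1\<close>.\<close>
  also have "\<dots> = (partial_deriv 1 (\<Gamma> 1 2 2) u * (d 1 u \<bullet> d 1 u) + partial_deriv 1 (\<Gamma> 2 2 2) u * (d 2 u \<bullet> d 1 u))
      - (partial_deriv 2 (\<Gamma> 1 1 2) u * (d 1 u \<bullet> d 1 u) + partial_deriv 2 (\<Gamma> 2 1 2) u * (d 2 u \<bullet> d 1 u))
      + \<Gamma> 1 2 2 u * (\<Gamma> 1 1 1 u * (d 1 u \<bullet> d 1 u) + \<Gamma> 2 1 1 u * (d 2 u \<bullet> d 1 u))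
      + \<Gamma> 2 2 2 u * (\<Gamma> 1 1 2 u * (d 1 u \<bullet> d 1 u) + \<Gamma> 2 1 2 u * (d 2 u \<bullet> d 1 u))
      - \<Gamma> 1 1 2 u * (\<Gamma> 1 2 1 u * (d 1 u \<bullet> d 1 u) + \<Gamma> 2 2 1 u * (d 2 u \<bullet> d 1 u))
      - \<Gamma> 2 1 2 u * (\<Gamma> 1 2 2 u * (d 1 u \<bullet> d 1 u) + \<Gamma> 2 2 2 u * (d 2 u \<bullet> d 1 u))"
    by (simp add: riemann_def sum_2 algebra_simps)
  also have "\<dots> = normal_dd 1 1 u \<bullet> normal_dd 2 2 u - normal_dd 1 2 u \<bullet> normal_dd 1 2 u"
    unfolding christoffel_lower[OF u] partial_deriv_christoffel_lower[OF u] normal_dd_inner[OF u]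
      third dd_commute[OF u, of 2 1]
    by (simp add: inner_commute algebra_simps)
  finally show ?thesis .
qed

lemma second_fundamental_form_eq:
  assumes u: "u \<in> U"
  shows "second_fundamental_form f u v w = (\<Sum>i\<in>UNIV. \<Sum>j\<in>UNIV. (v $ i * w $ j) *\<^sub>R normal_dd i j u)"
proof -
  let ?E = "\<lambda>x. \<Sum>j\<in>UNIV. w $ j *\<^sub>R d j x"
  let ?T = "range (frechet_derivative f (at u))"
  have E: "(?E has_derivative (\<lambda>h. \<Sum>j\<in>UNIV. w $ j *\<^sub>R frechet_derivative (d j) (at u) h)) (at u)"
    by (intro derivative_intros) (simp add: frechet_derivative_works[symmetric] diffs u)
  \<comment> \<open>The derivative of \<open>f\<close> in direction \<open>w\<close> is known to
    equal \<open>?E\<close> only on \<open>U\<close>, hence the transfer along an open set.\<close>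
  have "((\<lambda>x. frechet_derivative f (at x) w) has_derivative
      (\<lambda>h. \<Sum>j\<in>UNIV. w $ j *\<^sub>R frechet_derivative (d j) (at u) h)) (at u)"
    by (rule has_derivative_transform_within_open[OF E open_U u])
       (simp add: frechet_derivative_eq_partial_deriv diffs)
  then have ambient: "frechet_derivative (\<lambda>x. frechet_derivative f (at x) w) (at u) v
      = (\<Sum>i\<in>UNIV. \<Sum>j\<in>UNIV. (v $ i * w $ j) *\<^sub>R dd i j u)"
    by (subst frechet_derivative_at[symmetric], assumption)
       (simp add: frechet_derivative_eq_partial_deriv diffs u sum_2 algebra_simps)
  have lin: "linear (frechet_derivative f (at u))"
    using diffs(1)[OF u] by (rule linear_frechet_derivative)
  have "normal_part ?T (\<Sum>i\<in>UNIV. \<Sum>j\<in>UNIV. (v $ i * w $ j) *\<^sub>R dd i j u)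
      = (\<Sum>i\<in>UNIV. \<Sum>j\<in>UNIV. (v $ i * w $ j) *\<^sub>R normal_dd i j u)"
  proof (rule normal_part_eqI)
    show "subspace ?T" using lin by (simp add: linear_subspace_image)
    show "(\<Sum>i\<in>UNIV. \<Sum>j\<in>UNIV. (v $ i * w $ j) *\<^sub>R normal_dd i j u) \<bullet> t = 0" if "t \<in> ?T" for t
      using that normal_dd_orthogonal[OF u]
      by (auto simp: frechet_derivative_f[OF u] inner_sum_left inner_simps)
    \<comment> \<open>Coordinates of the tangent vector by which the ambient derivative differs from
      its normal part.\<close>
    let ?c = "\<lambda>k. \<Sum>i\<in>UNIV. \<Sum>j\<in>UNIV. (v $ i * w $ j) * \<Gamma> k i j u"
    have "(\<Sum>i\<in>UNIV. \<Sum>j\<in>UNIV. (v $ i * w $ j) *\<^sub>R dd i j u)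
        - (\<Sum>i\<in>UNIV. \<Sum>j\<in>UNIV. (v $ i * w $ j) *\<^sub>R normal_dd i j u)
      = frechet_derivative f (at u) (vector [?c 1, ?c 2])"
      by (simp add: frechet_derivative_f[OF u] normal_dd_def sum_2 algebra_simps)
    then show "(\<Sum>i\<in>UNIV. \<Sum>j\<in>UNIV. (v $ i * w $ j) *\<^sub>R dd i j u)
        - (\<Sum>i\<in>UNIV. \<Sum>j\<in>UNIV. (v $ i * w $ j) *\<^sub>R normal_dd i j u) \<in> ?T"
      by simp
  qed
  then show ?thesis by (simp add: second_fundamental_form_def ambient)
qed

end

section \<open>Components in orthonormal frames\<close>

text \<open>The two frames together form an orthonormal basis of the four-dimensional space, and
  \<open>y\<close> has components only along \<nu>. This is Parseval's identity for a normal vector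
  \<open>y\<close> and arbitrary \<open>z\<close>.\<close>

lemma inner_eq_sum_normal_frame:
  fixes t \<nu> :: "2 \<Rightarrow> real^4"
  assumes t: "\<And>i j. t i \<bullet> t j = (if i = j then 1 else 0)"
    and \<nu>: "\<And>\<alpha> \<beta>. \<nu> \<alpha> \<bullet> \<nu> \<beta> = (if \<alpha> = \<beta> then 1 else 0)"
    and t\<nu>: "\<And>i \<alpha>. t i \<bullet> \<nu> \<alpha> = 0"
    and y: "\<And>i. y \<bullet> t i = 0"
  shows "y \<bullet> z = (\<Sum>\<alpha>\<in>UNIV. (y \<bullet> \<nu> \<alpha>) * (z \<bullet> \<nu> \<alpha>))"
proof -
  have \<nu>t: "\<nu> \<alpha> \<bullet> t i = 0" for i \<alpha>
    using t\<nu>[of i \<alpha>] by (simp add: inner_commute)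
  have ne: "t 1 \<noteq> t 2" "\<nu> 1 \<noteq> \<nu> 2" "t i \<noteq> \<nu> \<alpha>" "t i \<noteq> 0" "\<nu> \<alpha> \<noteq> 0" for i \<alpha>
    using t[of 1 2] t[of 1 1] \<nu>[of 1 2] \<nu>[of 1 1] t[of i i] \<nu>[of \<alpha> \<alpha>] t\<nu>[of i \<alpha>] by auto
  let ?B = "{t 1, t 2, \<nu> 1, \<nu> 2}"
  have "card ?B = 4" using ne by simp
  moreover have "pairwise orthogonal ?B"
    using t\<nu> \<nu>t by (auto simp: pairwise_def orthogonal_def t \<nu>)
  then have "independent ?B"
    by (rule pairwise_orthogonal_independent) (use ne[THEN not_sym] in auto)
  ultimately have span: "span ?B = UNIV"
    using card_eq_dim[of ?B UNIV] by auto
  \<comment> \<open>This remainder is orthogonal to the whole basis, hence to itself.\<close>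
  define r where "r = y - (\<Sum>\<alpha>\<in>UNIV. (y \<bullet> \<nu> \<alpha>) *\<^sub>R \<nu> \<alpha>)"
  have "orthogonal r b" if "b \<in> ?B" for b
    using that y t\<nu> \<nu>
    by (auto simp: r_def orthogonal_def inner_diff_left sum_2 inner_left_distrib \<nu>t)
  then have "orthogonal r r"
    using orthogonal_to_span[of r ?B r] span by blast
  then have "y = (\<Sum>\<alpha>\<in>UNIV. (y \<bullet> \<nu> \<alpha>) *\<^sub>R \<nu> \<alpha>)"
    by (simp add: r_def orthogonal_def)
  then have "y \<bullet> z = (\<Sum>\<alpha>\<in>UNIV. (y \<bullet> \<nu> \<alpha>) *\<^sub>R \<nu> \<alpha>) \<bullet> z" by simp
  then show ?thesis by (simp add: inner_sum_left inner_commute[of z])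
qed

context immersed_patch
begin

text \<open>Passing from the coordinate basis to \<open>e\<close> multiplies the 2 by 2 determinant
  of a symmetric bilinear form by the square of \<delta>. Applied to the metric and to each normal
  component of the second fundamental form, this rescales the Gauss equation to the frame.\<close>

lemma gauss_curvature_eq_frame:
  assumes u: "u \<in> U" and e: "orthonormal_tangent_frame f u e" and \<nu>: "orthonormal_normal_frame f u \<nu>"
  defines "h \<equiv> sff_components f u e \<nu>"
  shows "gauss_curvature g u = (\<Sum>\<alpha>\<in>UNIV. h 1 1 \<alpha> * h 2 2 \<alpha> - (h 1 2 \<alpha>)\<^sup>2)"
proof -
  define t where "t i = frechet_derivative f (at u) (e i)" for i
  define n where "n i j \<alpha> = normal_dd i j u \<bullet> \<nu> \<alpha>" for i j \<alpha>
  define G where "G i j = d i u \<bullet> d j u" for i j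
  define \<delta> where "\<delta> = e 1 $ 1 * e 2 $ 2 - e 1 $ 2 * e 2 $ 1"
  have t: "t i \<bullet> t j = (if i = j then 1 else 0)" for i j
    using e by (simp add: t_def orthonormal_tangent_frame_def)
  have "normal_dd i j u \<bullet> normal_dd k l u = (\<Sum>\<alpha>\<in>UNIV. n i j \<alpha> * n k l \<alpha>)" for i j k l
    unfolding n_def
  proof (rule inner_eq_sum_normal_frame[where t = t])
    show "\<nu> \<alpha> \<bullet> \<nu> \<beta> = (if \<alpha> = \<beta> then 1 else 0)" for \<alpha> \<beta>
      using \<nu> by (simp add: orthonormal_normal_frame_def)
    show "t i \<bullet> \<nu> \<alpha> = 0" for i \<alpha>
      using \<nu> by (simp add: t_def orthonormal_normal_frame_def orthogonal_def inner_commute)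
    show "normal_dd i j u \<bullet> t m = 0" for m
      by (simp add: t_def frechet_derivative_f[OF u] inner_right_distrib normal_dd_orthogonal[OF u])
  qed (rule t)
  then have gauss: "gauss_curvature g u * det (g u) = (\<Sum>\<alpha>\<in>UNIV. n 1 1 \<alpha> * n 2 2 \<alpha> - n 1 2 \<alpha> * n 1 2 \<alpha>)"
    by (simp add: gauss_equation[OF u] sum_subtractf)
  have t_inner: "t i \<bullet> t j = (e i $ 1 * e j $ 1) * G 1 1 + (e i $ 1 * e j $ 2 + e i $ 2 * e j $ 1) * G 1 2
      + (e i $ 2 * e j $ 2) * G 2 2" for i j
    by (simp add: t_def frechet_derivative_f[OF u] G_def inner_left_distrib inner_right_distrib
        inner_commute[of "d 2 u" "d 1 u"] algebra_simps)
  \<comment> \<open>The right side is the Gram determinant of an orthonormal pair, which is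
    1.\<close>
  have "\<delta>\<^sup>2 * det (g u) = (t 1 \<bullet> t 1) * (t 2 \<bullet> t 2) - (t 1 \<bullet> t 2)\<^sup>2"
    unfolding t_inner det_g \<delta>_def G_def[symmetric] by algebra
  then have \<delta>: "\<delta>\<^sup>2 * det (g u) = 1" by (simp add: t)
  have sym: "n 2 1 \<alpha> = n 1 2 \<alpha>" for \<alpha>
    by (simp add: n_def normal_dd_commute[OF u, of 2 1])
  have h: "h i j \<alpha> = (e i $ 1 * e j $ 1) * n 1 1 \<alpha> + (e i $ 1 * e j $ 2 + e i $ 2 * e j $ 1) * n 1 2 \<alpha>
      + (e i $ 2 * e j $ 2) * n 2 2 \<alpha>" for i j \<alpha>
    using sym[of \<alpha>]
    by (simp add: h_def sff_components_def second_fundamental_form_eq[OF u] sum_2 n_def inner_left_distrib algebra_simps)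
  have "h 1 1 \<alpha> * h 2 2 \<alpha> - (h 1 2 \<alpha>)\<^sup>2 = \<delta>\<^sup>2 * (n 1 1 \<alpha> * n 2 2 \<alpha> - n 1 2 \<alpha> * n 1 2 \<alpha>)" for \<alpha>
    unfolding h \<delta>_def by algebra
  then have "(\<Sum>\<alpha>\<in>UNIV. h 1 1 \<alpha> * h 2 2 \<alpha> - (h 1 2 \<alpha>)\<^sup>2) = \<delta>\<^sup>2 * (gauss_curvature g u * det (g u))"
    by (simp add: gauss sum_distrib_left)
  also have "\<dots> = gauss_curvature g u"
    using \<delta> by (simp add: algebra_simps)
  finally show ?thesis ..
qed

lemma sff_components_commute:
  assumes u: "u \<in> U"
  shows "sff_components f u e \<nu> i j \<alpha> = sff_components f u e \<nu> j i \<alpha>"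
  using normal_dd_commute[OF u, of 2 1]
  by (simp add: sff_components_def second_fundamental_form_eq[OF u] sum_2 algebra_simps)

end

lemma simons_Z_eq:
  assumes "\<And>i j \<alpha>. h i j \<alpha> = h j i \<alpha>"
  shows "simons_Z h = 2 * (\<Sum>\<alpha>\<in>UNIV. h 1 1 \<alpha> * h 2 2 \<alpha> - (h 1 2 \<alpha>)\<^sup>2) * norm_squared (traceless h)
    - 2 * (normal_curvature h)\<^sup>2"
  unfolding simons_Z_def norm_squared_def traceless_def normal_curvature_def Rm_perp_squared_def
    mean_curvature_def sum_2 assms[of 2 1]
  by (simp add: power2_eq_square field_simps)

theorem proposition5p1:
  fixes X :: "'a topology"
    and \<A> :: "((real^2) set \<times> (real^2 \<Rightarrow> 'a)) set"
    and F :: "'a \<Rightarrow> real^4"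
    and U :: "(real^2) set" and x :: "real^2 \<Rightarrow> 'a" and u :: "real^2"
    and e :: "2 \<Rightarrow> real^2" and \<nu> :: "2 \<Rightarrow> real^4"
  assumes "smooth_surface X \<A>" and "smooth_immersion \<A> F"
    and "(U, x) \<in> \<A>" and "u \<in> U"
    and "orthonormal_tangent_frame (F \<circ> x) u e"
    and "orthonormal_normal_frame (F \<circ> x) u \<nu>"
  shows "let h = sff_components (F \<circ> x) u e \<nu>;
             K = gauss_curvature (induced_metric (F \<circ> x)) u
         in simons_Z h = 2 * K * norm_squared (traceless h) - 2 * \<bar>normal_curvature h\<bar>\<^sup>2"
proof -
  interpret immersed_patch "F \<circ> x" U
    using assms(1-3) unfolding smooth_surface_def smooth_immersion_def by unfold_locales fast+
  show ?thesis
    using simons_Z_eq[OF sff_components_commute[OF assms(4), of e \<nu>]]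
      gauss_curvature_eq_frame[OF assms(4-6)]
    by (simp add: Let_def)
qed

end
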